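(* Let $\mathcal{S}=S_1,S_2,\ldots,S_n$ be an ensemble of labeled stub-stars with maximum degree $\Delta$. Then $\mathcal{S}$ is forest realizable if and only if it is multigraph realizable and for every subset $I$ of the set of colors $\{(i,i)\mid 1\le i\le\Delta\}\cup\binom{\{1,\ldots,\Delta\}}{2}$, the multichromatic degree sequence $(d_I(S_1),d_I(S_2),\ldots,d_I(S_n))$ is forest realizable.
   Context: A labeled stub-star is a vertex with some number $d$ of stubs (half-edges), each stub labeled by a positive integer; $d$ is its degree. An ensemble is a finite multiset $\mathcal{S}=\{S_1,\ldots,S_n\}$ of labeled stub-stars. A (multi)graph $G$ on vertices $v_1,\ldots,v_n$ is a realization of $\mathcal{S}$ if for each $i$ the multiset of degrees of the neighbors of $v_i$ (counted with edge multiplicity, one for each half-edge at $v_i$; a loop at $v_i$ contributes two neighbors of degree $d(v_i)$ and contributes $2$ to $d(v_i)$) equals the multiset of labels of $S_i$; in particular $d(v_i)$ is the degree of $S_i$. $\mathcal{S}$ is multigraph (resp. forest) realizable if it has a realization that is a multigraph, with loops and parallel edges allowed (resp. a forest). The chromatic degree $d_{(i,j)}(S)$ of a stub-star $S$ is: the number of labels $j$ of $S$ if $S$ has degree $i$; the number of labels $i$ of $S$ if $S$ has degree $j$; and $0$ if the degree of $S$ is neither $i$ nor $j$. Elements $\{i,j\}$ of $\binom{\{1,\ldots,\Delta\}}{2}$ are unordered pairs, written $(i,j)$. For a set $I$ of colors, the multichromatic degree is $d_I(S_l):=\sum_{(i,j)\in I}d_{(i,j)}(S_l)$. A sequence of non-negative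 integers $(e_1,\ldots,e_n)$ is forest realizable if there is a forest on vertices $v_1,\ldots,v_n$ with $d(v_l)=e_l$ for all $l$. *)

theory Defs
  imports "HOL-Library.Multiset" "HOL-Library.Uprod"
begin

text \<open>
  A multigraph on the vertices \<open>0, \<dots>, n - 1\<close> is given by its multiset of edges. An edge is an
  unordered pair; \<open>Upair v v\<close> is a loop, and multiplicities greater than 1 are parallel edges.
\<close>

type_synonym edges = "nat uprod multiset"

definition multigraph :: "nat \<Rightarrow> edges \<Rightarrow> bool" where
  "multigraph n G \<longleftrightarrow> (\<forall>e \<in># G. set_uprod e \<subseteq> {..<n})"

text \<open>A loop is counted in both summands, so it contributes 2 to the degree.\<close>

definition degree :: "edges \<Rightarrow> nat \<Rightarrow> nat" where
  "degree G v = size {#e \<in># G. v \<in> set_uprod e#} + count G (Upair v v)"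

text \<open>One entry for each half-edge at \<open>v\<close>, so a loop makes \<open>v\<close> its own neighbour twice.\<close>

definition neighbours :: "nat \<Rightarrow> edges \<Rightarrow> nat \<Rightarrow> nat multiset" where
  "neighbours n G v =
     (\<Sum>w<n. replicate_mset (if w = v then 2 * count G (Upair v v) else count G (Upair v w)) w)"

definition is_cycle :: "edges \<Rightarrow> nat list \<Rightarrow> bool" where
  "is_cycle G vs \<longleftrightarrow> length vs \<ge> 3 \<and> distinct vs \<and>
     (\<forall>i < length vs. Upair (vs ! i) (vs ! (Suc i mod length vs)) \<in># G)"

text \<open>The two middle conjuncts exclude loops and parallel edges, i.e. cycles of length 1 and 2.\<close>

definition forest :: "nat \<Rightarrow> edges \<Rightarrow> bool" where
  "forest n G \<longleftrightarrow> multigraph n G \<and> (\<forall>e \<in># G. proper_uprod e) \<and> (\<forall>e. count G e \<le> 1) \<and>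
     \<not> (\<exists>vs. is_cycle G vs)"

text \<open>
  A labeled stub-star is the multiset of its labels, one for each stub; its degree is its size.
  An ensemble is listed as \<open>S ! 0, \<dots>, S ! (length S - 1)\<close>.
\<close>

type_synonym stub_star = "nat multiset"

definition ensemble :: "stub_star list \<Rightarrow> bool" where
  "ensemble S \<longleftrightarrow> (\<forall>s \<in> set S. \<forall>j \<in># s. j \<ge> 1)"

text \<open>The additional 0 only matters for the empty ensemble.\<close>

definition max_degree :: "stub_star list \<Rightarrow> nat" where
  "max_degree S = Max (insert 0 (size ` set S))"

definition realization :: "edges \<Rightarrow> stub_star list \<Rightarrow> bool" where
  "realization G S \<longleftrightarrow> multigraph (length S) G \<and>
     (\<forall>i < length S. image_mset (degree G) (neighbours (length S) G i) = S ! i)"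

definition multigraph_realizable :: "stub_star list \<Rightarrow> bool" where
  "multigraph_realizable S \<longleftrightarrow> (\<exists>G. realization G S)"

definition forest_realizable :: "stub_star list \<Rightarrow> bool" where
  "forest_realizable S \<longleftrightarrow> (\<exists>G. realization G S \<and> forest (length S) G)"

definition forest_realizable_sequence :: "nat list \<Rightarrow> bool" where
  "forest_realizable_sequence es \<longleftrightarrow>
     (\<exists>G. forest (length es) G \<and> (\<forall>l < length es. degree G l = es ! l))"

definition colors :: "nat \<Rightarrow> nat uprod set" where
  "colors \<Delta> = {Upair i i | i. 1 \<le> i \<and> i \<le> \<Delta>} \<union>
     {Upair i j | i j. i \<in> {1..\<Delta>} \<and> j \<in> {1..\<Delta>} \<and> i \<noteq> j}"

lift_definition chromatic_degree :: "nat uprod \<Rightarrow> stub_star \<Rightarrow> nat" is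
  "\<lambda>(i, j) s. if size s = i then count s j else if size s = j then count s i else 0"
  by (auto simp: fun_eq_iff)

lemma chromatic_degree_Upair:
  "chromatic_degree (Upair i j) s =
     (if size s = i then count s j else if size s = j then count s i else 0)"
  by transfer simp

definition multichromatic_degree :: "nat uprod set \<Rightarrow> stub_star \<Rightarrow> nat" where
  "multichromatic_degree I s = (\<Sum>c \<in> I. chromatic_degree c s)"

lemma size_neighbours:
  assumes "multigraph n G" "v < n"
  shows "size (neighbours n G v) = degree G v"
proof -
  let ?f = "\<lambda>G w. if w = v then 2 * count G (Upair v v) else count G (Upair v w)"
  have "size (neighbours n G v) = (\<Sum>w<n. ?f G w)"
    by (simp add: neighbours_def size_multiset_sum)
  also have "\<dots> = degree G v"
    using assms(1)
  proof (induction G)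
    case empty
    show ?case by (simp add: degree_def)
  next
    case (add e G)
    obtain a b where e: "e = Upair a b" by (cases e)
    from add.prems have ab: "a < n" "b < n" and G: "multigraph n G"
      by (auto simp: multigraph_def e)
    have "(\<Sum>w<n. ?f (add_mset e G) w) =
        (\<Sum>w<n. ?f G w + ((if w = b then if a = v then 1 else 0 else 0) +
                          (if w = a then if b = v then 1 else 0 else 0)))"
      by (rule sum.cong) (auto simp: e)
    also have "\<dots> = (\<Sum>w<n. ?f G w) + ((if a = v then 1 else 0) + (if b = v then 1 else 0))"
      using ab by (simp only: sum.distrib) simp
    also have "\<dots> = degree (add_mset e G) v"
      using add.IH[OF G] by (auto simp: degree_def e)
    finally show ?case .
  qed
  finally show ?thesis .
qed

end

theory Submission
  imports Defs
begin

text \<open>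
  Write \<open>d v\<close> for the degree of the stub-star at \<open>v\<close>. In any realization an edge \<open>{a, b}\<close> has the
  colour \<open>{d a, d b}\<close>, and the multichromatic degree \<open>d\<^sub>I\<close> is the ordinary degree in the subgraph
  \<open>G\<^sub>I\<close> of the edges whose colour lies in \<open>I\<close> (\<open>multichromatic_degree_eq_degree\<close>). A subgraph of
  a forest is a forest, so the conditions are necessary.

  For sufficiency, replace two edges \<open>uv\<close>, \<open>xy\<close> of one colour, with \<open>d u = d x\<close> and
  \<open>d v = d y\<close>, by \<open>uy\<close> and \<open>xv\<close>. This keeps all labels, hence gives a realization again. Only
  swaps are used in which \<open>uv\<close> lies on a cycle that avoids \<open>xy\<close>: then \<open>u\<close> and \<open>v\<close> stay connected
  by the rest of the cycle, so all four vertices end up in one component and connectivity can only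
  grow. Start from a realization in which no sequence of such swaps makes the connectivity grow any more. If a
  realization reachable from it is acyclic, it is the required forest.

  Otherwise let \<open>R\<close> be the set of the colours that occur on a cycle of some reachable realization.
  Edges of other colours are bridges in all reachable realizations. Since the connectivity of the
  whole graph is maximal, a swap cannot merge two components of \<open>G\<^sub>R\<close>: the bridges that linked
  them would then lie on a cycle. So the components of \<open>G\<^sub>R\<close>, as sets of vertices, are the same for
  all reachable realizations (\<open>swap_conn_cycle_colours\<close>). Consequently, every colour of \<open>R\<close> lives
  in a single component (\<open>cycle_colour_connected\<close>): in a realization where an edge of this colour
  lies on a cycle, swapping it with any other edge of the colour connects the ends of both.

  Take a component of \<open>G\<^sub>R\<close> that contains a cycle, and let \<open>H\<close> be the set of its colours. Then
  \<open>G\<^sub>H\<close> is connected on the set of its nonisolated vertices and contains a cycle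
  (\<open>acyclic_or_connected_colours\<close>), so it has at least as many edges as nonisolated vertices. No
  forest has the same degrees (\<open>no_forest_with_connected_cyclic_degrees\<close>), which contradicts the
  hypothesis for \<open>H\<close>.
\<close>

section \<open>Degrees and neighbours, edge by edge\<close>

lemma degree_empty [simp]: "degree {#} v = 0"
  by (simp add: degree_def)

lemma degree_add_edge:
  "degree (add_mset (Upair a b) G) v =
     degree G v + (if a = v then 1 else 0) + (if b = v then 1 else 0)"
  by (auto simp: degree_def)

lemma degree_pos_iff: "degree G v > 0 \<longleftrightarrow> (\<exists>e \<in># G. v \<in> set_uprod e)"
proof (induction G)
  case empty
  then show ?case by simp
next
  case (add e G)
  then show ?case by (cases e) (auto simp: degree_add_edge)
qed

lemma multigraph_empty [simp]: "multigraph n {#}"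
  by (simp add: multigraph_def)

lemma multigraph_add_edge [simp]:
  "multigraph n (add_mset (Upair a b) G) \<longleftrightarrow> a < n \<and> b < n \<and> multigraph n G"
  by (auto simp: multigraph_def)

lemma multigraph_mono: "multigraph n G \<Longrightarrow> M \<subseteq># G \<Longrightarrow> multigraph n M"
  by (auto simp: multigraph_def dest: mset_subset_eqD)

lemma sum_degree:
  assumes "multigraph n G"
  shows "(\<Sum>v<n. degree G v) = 2 * size G"
  using assms
proof (induction G)
  case empty
  then show ?case by simp
next
  case (add e G)
  then show ?case by (cases e) (simp add: degree_add_edge sum.distrib)
qed

lemma count_neighbours:
  "count (neighbours n G v) w =
     (if w < n then if w = v then 2 * count G (Upair v v) else count G (Upair v w) else 0)"
proof -
  have "count (neighbours n G v) w =
      (\<Sum>x<n. if x = w then if x = v then 2 * count G (Upair v v) else count G (Upair v x) else 0)"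
    unfolding neighbours_def count_sum by (rule sum.cong) auto
  then show ?thesis by (simp add: sum.delta)
qed

lemma neighbours_add_edge:
  assumes "a < n" "b < n"
  shows "neighbours n (add_mset (Upair a b) G) v =
     neighbours n G v + (if a = v then {#b#} else {#}) + (if b = v then {#a#} else {#})"
  by (rule multiset_eqI) (use assms in \<open>auto simp: count_neighbours\<close>)

lemma neighbours_empty [simp]: "neighbours n {#} v = {#}"
  by (rule multiset_eqI) (simp add: count_neighbours)

lemma neighbours_less: "w \<in># neighbours n G v \<Longrightarrow> w < n"
  by (metis count_neighbours count_eq_zero_iff)

lemma realization_degree:
  assumes "realization G S" "v < length S"
  shows "degree G v = size (S ! v)"
proof -
  have "S ! v = image_mset (degree G) (neighbours (length S) G v)"
    using assms by (simp add: realization_def)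
  then have "size (S ! v) = size (neighbours (length S) G v)" by simp
  also have "\<dots> = degree G v"
    using assms by (simp add: realization_def size_neighbours)
  finally show ?thesis by simp
qed

text \<open>
  The labels are prescribed by the degrees in \<open>G\<close>, which change their form when \<open>G\<close> is modified.
  The sizes of the stub-stars can be used instead, because the right-hand side already forces the
  degrees to be these sizes.
\<close>

lemma realization_iff_sizes:
  "realization G S \<longleftrightarrow> multigraph (length S) G \<and>
     (\<forall>v < length S. image_mset (\<lambda>w. size (S ! w)) (neighbours (length S) G v) = S ! v)"
  (is "_ \<longleftrightarrow> _ \<and> ?N")
proof -
  have *: "image_mset (degree G) (neighbours (length S) G v) =
      image_mset (\<lambda>w. size (S ! w)) (neighbours (length S) G v)"
    if "\<And>w. w < length S \<Longrightarrow> degree G w = size (S ! w)" for v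
    by (rule image_mset_cong) (use that neighbours_less in blast)
  have "degree G w = size (S ! w)" if "multigraph (length S) G" ?N "w < length S" for w
  proof -
    have "size (S ! w) = size (image_mset (\<lambda>x. size (S ! x)) (neighbours (length S) G w))"
      using that(2,3) by presburger
    then show ?thesis using that(1,3) by (simp add: size_neighbours)
  qed
  with * realization_degree show ?thesis
    unfolding realization_def by (metis (no_types, lifting) realization_def)
qed

section \<open>Connectivity and bridges\<close>

definition conn :: "edges \<Rightarrow> nat \<Rightarrow> nat \<Rightarrow> bool" where
  "conn M = (\<lambda>x y. Upair x y \<in># M)\<^sup>*\<^sup>*"

lemma conn_refl [simp]: "conn M x x"
  by (simp add: conn_def)

lemma conn_trans: "conn M x y \<Longrightarrow> conn M y z \<Longrightarrow> conn M x z"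
  by (simp add: conn_def)

lemma conn_edge: "Upair x y \<in># M \<Longrightarrow> conn M x y"
  by (auto simp: conn_def)

lemma conn_sym: "conn M x y \<Longrightarrow> conn M y x"
proof -
  have "symp (\<lambda>x y. Upair x y \<in># M)"
    by (rule sympI) (metis Upair_inject)
  then show "conn M x y \<Longrightarrow> conn M y x"
    unfolding conn_def by (meson symp_rtranclp sympD)
qed

lemma conn_least:
  assumes "conn M x y" and "\<And>a b. Upair a b \<in># M \<Longrightarrow> conn M' a b"
  shows "conn M' x y"
  using assms(1) unfolding conn_def[of M]
  by (induction rule: rtranclp_induct) (auto intro: conn_trans assms(2))

lemma conn_mono: "conn M x y \<Longrightarrow> set_mset M \<subseteq> set_mset M' \<Longrightarrow> conn M' x y"
  by (erule conn_least) (auto intro: conn_edge)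

lemma conn_add_edge:
  "conn (add_mset (Upair u v) M) x y \<longleftrightarrow>
     conn M x y \<or> conn M x u \<and> conn M v y \<or> conn M x v \<and> conn M u y"
  (is "?L \<longleftrightarrow> ?R x y")
proof
  assume ?L
  then show "?R x y"
    unfolding conn_def[of "add_mset _ _"]
  proof (induction rule: rtranclp_induct)
    case base
    then show ?case by simp
  next
    case (step y z)
    have "Upair y z \<in># M \<or> y = u \<and> z = v \<or> y = v \<and> z = u"
      using step.hyps(2) by auto
    then show ?case
      using step.IH by (meson conn_edge conn_trans conn_sym conn_refl)
  qed
next
  have "conn M a b \<Longrightarrow> conn (add_mset (Upair u v) M) a b" for a b
    by (erule conn_mono) auto
  moreover have "conn (add_mset (Upair u v) M) u v"
    by (rule conn_edge) simp
  ultimately show "?R x y \<Longrightarrow> ?L"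
    by (meson conn_trans conn_sym)
qed

lemma conn_multigraph:
  assumes "conn M x y" "multigraph n M" "x \<noteq> y"
  shows "x < n \<and> y < n"
proof -
  have "x = y \<or> x < n \<and> y < n"
    using assms(1) unfolding conn_def
  proof (induction rule: rtranclp_induct)
    case (step y z)
    then show ?case using assms(2) by (auto simp: multigraph_def)
  qed simp
  with assms(3) show ?thesis by simp
qed

definition joins :: "edges \<Rightarrow> nat uprod \<Rightarrow> bool" where
  "joins M e \<longleftrightarrow> (\<forall>x \<in> set_uprod e. \<forall>y \<in> set_uprod e. conn M x y)"

lemma joins_Upair [simp]: "joins M (Upair u v) \<longleftrightarrow> conn M u v"
  by (auto simp: joins_def intro: conn_sym)

lemma joins_mono: "joins M e \<Longrightarrow> set_mset M \<subseteq> set_mset M' \<Longrightarrow> joins M' e"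
  by (cases e) (auto intro: conn_mono)

text \<open>
  A multigraph is a forest exactly if every edge is a bridge. In this form loops, parallel edges
  and longer cycles need no separate treatment.
\<close>

definition acyclic_edges :: "edges \<Rightarrow> bool" where
  "acyclic_edges M \<longleftrightarrow> (\<forall>e \<in># M. \<not> joins (M - {#e#}) e)"

lemma acyclic_edges_mono:
  assumes "acyclic_edges G" "M \<subseteq># G"
  shows "acyclic_edges M"
  unfolding acyclic_edges_def
proof (intro ballI notI)
  fix e assume "e \<in># M" "joins (M - {#e#}) e"
  moreover have "set_mset (M - {#e#}) \<subseteq> set_mset (G - {#e#})"
    using assms(2) by (auto simp: in_diff_count mset_subset_eq_exists_conv)
  ultimately show False
    using assms joins_mono by (meson acyclic_edges_def mset_subset_eqD)
qed

lemma simple_path: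
  assumes "R\<^sup>*\<^sup>* u v"
  shows "\<exists>p. p \<noteq> [] \<and> hd p = u \<and> last p = v \<and> distinct p \<and> successively R p"
  using assms
proof (induction rule: converse_rtranclp_induct)
  case base
  show ?case by (rule exI[of _ "[v]"]) simp
next
  case (step u u')
  then obtain p where p: "p \<noteq> []" "hd p = u'" "last p = v" "distinct p" "successively R p"
    by blast
  show ?case
  proof (cases "u \<in> set p")
    case True
    then obtain xs ys where "p = xs @ u # ys"
      by (meson split_list)
    with p show ?thesis
      by (intro exI[of _ "u # ys"]) (auto simp: successively_append_iff)
  next
    case False
    with p step.hyps(1) show ?thesis
      by (intro exI[of _ "u # p"]) (auto simp: successively_Cons)
  qed
qed

text \<open>
  If an edge is not a bridge, a simple path between its ends that avoids it has one vertex (the edge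
  is a loop), two vertices (there is a parallel edge), or it closes up to a cycle in the sense of
  \<^const>\<open>is_cycle\<close>. Conversely, the closing edge of such a cycle is not a bridge.
\<close>

lemma forest_iff_acyclic:
  assumes "multigraph n G"
  shows "forest n G \<longleftrightarrow> acyclic_edges G"
proof
  assume F: "forest n G"
  show "acyclic_edges G"
    unfolding acyclic_edges_def
  proof (intro ballI notI)
    fix e assume e: "e \<in># G" "joins (G - {#e#}) e"
    obtain u v where uv: "e = Upair u v" by (cases e)
    have "u \<noteq> v"
      using F e(1) by (auto simp: forest_def uv)
    obtain p where p: "p \<noteq> []" "hd p = u" "last p = v" "distinct p"
      "successively (\<lambda>x y. Upair x y \<in># G - {#e#}) p"
      using simple_path[of "\<lambda>x y. Upair x y \<in># G - {#e#}" u v] e(2)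
      unfolding uv joins_Upair conn_def by metis
    have adj: "Upair (p ! i) (p ! Suc i) \<in># G - {#e#}" if "Suc i < length p" for i
      using p(5) that by (simp add: successively_conv_nth)
    have ends: "p ! 0 = u" "p ! (length p - 1) = v"
      using p by (simp_all add: hd_conv_nth last_conv_nth)
    have "length p \<noteq> 0" "length p \<noteq> 1"
      using p(1) ends \<open>u \<noteq> v\<close> by auto
    moreover have "length p \<noteq> 2"
    proof
      assume "length p = 2"
      then have "e \<in># G - {#e#}"
        using adj[of 0] ends by (simp add: uv)
      then have "count G e > 1"
        by (simp add: in_diff_count)
      moreover have "count G e \<le> 1"
        using F by (simp add: forest_def)
      ultimately show False by simp
    qed
    ultimately have "length p \<ge> 3" by linarith
    have "Upair (p ! i) (p ! (Suc i mod length p)) \<in># G" if "i < length p" for i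
    proof (cases "Suc i < length p")
      case True
      then show ?thesis using adj[of i] by (auto dest: in_diffD)
    next
      case False
      with that have "Suc i = length p" by simp
      then have "i = length p - 1" "Suc i mod length p = 0" by simp_all
      moreover have "Upair v u = e" by (simp add: uv)
      ultimately show ?thesis using ends e(1) by simp
    qed
    then have "is_cycle G p"
      using \<open>length p \<ge> 3\<close> p(4) by (simp add: is_cycle_def)
    with F show False by (auto simp: forest_def)
  qed
next
  assume A: "acyclic_edges G"
  have "proper_uprod e" if "e \<in># G" for e
    using A that by (cases e) (auto simp: acyclic_edges_def)
  moreover have "count G e \<le> 1" for e
  proof (rule ccontr)
    assume "\<not> count G e \<le> 1"
    then have "e \<in># G - {#e#}"
      by (simp add: in_diff_count)
    then have "e \<in># G" by (rule in_diffD)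
    moreover have "joins (G - {#e#}) e"
      using \<open>e \<in># G - {#e#}\<close> by (cases e) (auto intro: conn_edge)
    ultimately show False using A by (auto simp: acyclic_edges_def)
  qed
  moreover have False if c: "is_cycle G vs" for vs
  proof -
    \<comment> \<open>The closing edge of the cycle: the other edges still join its ends.\<close>
    define k where "k = length vs - 1"
    define e where "e = Upair (vs ! 0) (vs ! k)"
    have len: "length vs \<ge> 3" "distinct vs" "length vs = Suc k"
      using c by (auto simp: is_cycle_def k_def)
    have edge: "Upair (vs ! i) (vs ! Suc i) \<in># G - {#e#}" if "i < k" for i
    proof -
      have "Upair (vs ! i) (vs ! (Suc i mod length vs)) \<in># G"
        using c that len(3) less_SucI unfolding is_cycle_def by metis
      moreover have "Suc i mod length vs = Suc i"
        using that len by simp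
      moreover have "Upair (vs ! i) (vs ! Suc i) \<noteq> e"
        using that len by (auto simp: e_def nth_eq_iff_index_eq)
      ultimately show ?thesis using that len by (simp add: in_diff_count)
    qed
    have "conn (G - {#e#}) (vs ! 0) (vs ! i)" if "i \<le> k" for i
      using that
    proof (induction i)
      case (Suc i)
      then show ?case using edge[of i] by (auto intro: conn_trans conn_edge)
    qed simp
    then have "joins (G - {#e#}) e" by (simp add: e_def)
    moreover have "e \<in># G"
      using c len unfolding is_cycle_def e_def
      by (metis Upair_inject lessI mod_self)
    ultimately show False using A by (auto simp: acyclic_edges_def)
  qed
  ultimately show "forest n G"
    using assms by (auto simp: forest_def)
qed

text \<open>
  Think of \<open>B\<close> as having coarser components than \<open>A\<close>. If the edges of \<open>K\<close> connect \<open>x\<close> and \<open>y\<close> over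
  \<open>A\<close> and are needed for that, add them one at a time: the first edge that connects \<open>x\<close> and \<open>y\<close>
  closes a cycle with the connection of \<open>x\<close> and \<open>y\<close> that exists in \<open>B\<close>, so it is not a bridge of
  \<open>B + K\<close>.
\<close>

lemma bridges_do_not_connect:
  assumes "conn (A + K) x y" "conn B x y"
    and "\<And>a b. conn A a b \<Longrightarrow> conn B a b"
    and "\<And>g. g \<in># K \<Longrightarrow> \<not> joins (B + K - {#g#}) g"
  shows "conn A x y"
  using assms(1,4)
proof (induction K)
  case empty
  then show ?case by simp
next
  case (add g K)
  obtain a b where g: "g = Upair a b" by (cases g)
  \<comment> \<open>The components of A + K refine those of B + K, since those of A refine those of B.\<close>
  have up: "conn (B + K) p q" if "conn (A + K) p q" for p q
    using that
  proof (rule conn_least)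
    fix c d assume "Upair c d \<in># A + K"
    then consider "Upair c d \<in># A" | "Upair c d \<in># K" by auto
    then show "conn (B + K) c d"
    proof cases
      case 1
      then show ?thesis by (meson assms(3) conn_edge conn_mono mset_subset_eq_add_left set_mset_mono)
    qed (auto intro: conn_edge)
  qed
  have xy: "conn (B + K) x y"
    using assms(2) by (rule conn_mono) auto
  have bridge: "\<not> conn (B + K) a b"
    using add.prems(2)[of g] by (simp add: g)
  have "conn (A + K) x y"
    using add.prems(1) up xy bridge unfolding g
    by (simp add: conn_add_edge) (meson conn_sym conn_trans)
  moreover have "\<not> joins (B + K - {#h#}) h" if "h \<in># K" for h
  proof -
    have "\<not> joins (B + add_mset g K - {#h#}) h"
      using that by (intro add.prems(2)) simp
    moreover have "set_mset (B + K - {#h#}) \<subseteq> set_mset (B + add_mset g K - {#h#})"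
      by (auto simp: in_diff_count)
    ultimately show ?thesis using joins_mono by blast
  qed
  ultimately show ?case by (rule add.IH)
qed


section \<open>Counting components\<close>

text \<open>
  The least vertex of each component represents it, so that counting leaders counts components.
\<close>

definition leaders :: "nat \<Rightarrow> edges \<Rightarrow> nat set" where
  "leaders n M = {v. v < n \<and> (\<forall>w<v. \<not> conn M w v)}"

lemma finite_leaders [simp]: "finite (leaders n M)"
  by (simp add: leaders_def)

lemma leaders_empty: "leaders n {#} = {..<n}"
  by (auto simp: leaders_def conn_def elim: rtranclp.cases)

lemma leader_exists: "\<exists>r \<le> u. conn M r u \<and> (\<forall>w<r. \<not> conn M w r)"
proof -
  define r where "r = (LEAST w. conn M w u)"
  have "conn M r u" unfolding r_def by (rule LeastI[of _ u]) simp
  moreover have "r \<le> u" unfolding r_def by (rule Least_le) simp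
  moreover have "\<not> conn M w r" if "w < r" for w
  proof -
    have "\<not> conn M w u" using that unfolding r_def by (rule not_less_Least)
    then show ?thesis using \<open>conn M r u\<close> conn_trans by blast
  qed
  ultimately show ?thesis by blast
qed

lemma leaders_add_redundant:
  "conn M u v \<Longrightarrow> leaders n (add_mset (Upair u v) M) = leaders n M"
proof -
  assume uv: "conn M u v"
  have "conn M x y" if "conn M x u \<and> conn M v y \<or> conn M x v \<and> conn M u y" for x y
    using that uv conn_sym[OF uv] conn_trans by meson
  then have "conn (add_mset (Upair u v) M) x y \<longleftrightarrow> conn M x y" for x y
    unfolding conn_add_edge by blast
  then show ?thesis by (simp add: leaders_def)
qed

text \<open>
  Of the leaders of the two components that are merged, exactly the larger one is lost.
\<close>

lemma card_leaders_add_bridge: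
  assumes "\<not> conn M u v" "u < n" "v < n"
  shows "card (leaders n M) = Suc (card (leaders n (add_mset (Upair u v) M)))"
proof -
  \<comment> \<open>The case in which the leader of v is the larger one; the other case is symmetric.\<close>
  have *: "card (leaders n M) = Suc (card (leaders n (add_mset (Upair u v) M)))"
    if "\<not> conn M u v" "u < n" "v < n" "conn M ru u" "conn M rv v" "rv \<le> v" "ru < rv"
      "\<forall>w<ru. \<not> conn M w ru" "\<forall>w<rv. \<not> conn M w rv"
    for u v ru rv
  proof -
    let ?M = "add_mset (Upair u v) M"
    have "rv \<in> leaders n M"
      using that by (simp add: leaders_def)
    moreover have "leaders n ?M = leaders n M - {rv}"
    proof (intro set_eqI iffI)
      fix w assume w: "w \<in> leaders n ?M"
      have "conn ?M ru rv"
        unfolding conn_add_edge using that conn_sym by blast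
      with w \<open>ru < rv\<close> have "w \<noteq> rv" by (auto simp: leaders_def)
      moreover have "w \<in> leaders n M"
        using w by (auto simp: leaders_def conn_add_edge)
      ultimately show "w \<in> leaders n M - {rv}" by simp
    next
      fix w assume w: "w \<in> leaders n M - {rv}"
      have unique: "x = y" if "conn M x y" "\<forall>w<x. \<not> conn M w x" "\<forall>w<y. \<not> conn M w y" for x y
        using that conn_sym by (metis nat_neq_iff)
      have False if w': "w' < w" "conn ?M w' w" for w'
      proof -
        consider "conn M w' w" | "conn M w' u" "conn M v w" | "conn M w' v" "conn M u w"
          using w'(2) unfolding conn_add_edge by blast
        then show False
        proof cases
          case 1
          then show ?thesis using w w'(1) by (auto simp: leaders_def)
        next
          case 2
          then have "conn M rv w" using \<open>conn M rv v\<close> conn_trans by blast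
          then have "rv = w"
            using w \<open>\<forall>w<rv. \<not> conn M w rv\<close> by (intro unique) (auto simp: leaders_def)
          then show ?thesis using w by simp
        next
          case 3
          then have "conn M ru w" using \<open>conn M ru u\<close> conn_trans by blast
          then have "ru = w"
            using w \<open>\<forall>w<ru. \<not> conn M w ru\<close> by (intro unique) (auto simp: leaders_def)
          then have "w' < rv" using w'(1) \<open>ru < rv\<close> by simp
          moreover have "conn M w' rv"
            using 3(1) \<open>conn M rv v\<close> conn_sym conn_trans by blast
          ultimately show ?thesis using \<open>\<forall>w<rv. \<not> conn M w rv\<close> by blast
        qed
      qed
      then show "w \<in> leaders n ?M" using w by (auto simp: leaders_def)
    qed
    ultimately show ?thesis
      by (metis card_Suc_Diff1 finite_leaders)
  qed
  obtain ru where ru: "ru \<le> u" "conn M ru u" "\<forall>w<ru. \<not> conn M w ru"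
    using leader_exists by blast
  obtain rv where rv: "rv \<le> v" "conn M rv v" "\<forall>w<rv. \<not> conn M w rv"
    using leader_exists by blast
  have "ru \<noteq> rv"
    using assms(1) ru rv conn_sym conn_trans by blast
  then consider "ru < rv" | "rv < ru" by linarith
  then show ?thesis
  proof cases
    case 1
    then show ?thesis using *[of u v ru rv] assms ru rv by simp
  next
    case 2
    have "\<not> conn M v u" using assms(1) conn_sym by blast
    moreover have eq: "Upair u v = Upair v u" by simp
    ultimately show ?thesis unfolding eq using *[of v u rv ru] 2 assms ru rv by simp
  qed
qed

lemma card_leaders_ge: "multigraph n M \<Longrightarrow> n \<le> card (leaders n M) + size M"
proof (induction M)
  case empty
  then show ?case by (simp add: leaders_empty)
next
  case (add e M)
  obtain u v where e: "e = Upair u v" by (cases e)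
  with add show ?case
    using leaders_add_redundant[of M u v n] card_leaders_add_bridge[of M u v n]
    by (cases "conn M u v") auto
qed

lemma card_leaders_acyclic:
  "multigraph n M \<Longrightarrow> acyclic_edges M \<Longrightarrow> card (leaders n M) + size M = n"
proof (induction M)
  case empty
  then show ?case by (simp add: leaders_empty)
next
  case (add e M)
  obtain u v where e: "e = Upair u v" by (cases e)
  have "acyclic_edges M" using add.prems(2) by (rule acyclic_edges_mono) simp
  moreover have "\<not> conn M u v" using add.prems(2) by (auto simp: acyclic_edges_def e)
  ultimately show ?case
    using add card_leaders_add_bridge[of M u v n] by (simp add: e)
qed

text \<open>
  A forest has \<open>n\<close> minus its number of edges as number of components, any other graph at least that
  many; and \<open>M\<close> has at most as many components as \<open>F\<close>. This is the inequality between an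
  independent set and a spanning set in the graphic matroid.
\<close>

lemma acyclic_size_le:
  assumes "multigraph n F" "acyclic_edges F" "multigraph n M" "\<And>e. e \<in># F \<Longrightarrow> joins M e"
  shows "size F \<le> size M"
proof -
  have "conn M x y" if "conn F x y" for x y
    using that
  proof (rule conn_least)
    fix a b assume "Upair a b \<in># F"
    from assms(4)[OF this] show "conn M a b" by simp
  qed
  then have "leaders n M \<subseteq> leaders n F" by (auto simp: leaders_def)
  then have "card (leaders n M) \<le> card (leaders n F)" by (simp add: card_mono)
  with card_leaders_acyclic[OF assms(1,2)] card_leaders_ge[OF assms(3)] show ?thesis
    by linarith
qed

section \<open>Colours\<close>

definition coloured :: "(nat \<Rightarrow> nat) \<Rightarrow> nat uprod set \<Rightarrow> edges \<Rightarrow> edges" where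
  "coloured d I G = filter_mset (\<lambda>e. map_uprod d e \<in> I) G"

lemma coloured_empty [simp]: "coloured d I {#} = {#}"
  by (simp add: coloured_def)

lemma coloured_add [simp]:
  "coloured d I (add_mset e G) =
     (if map_uprod d e \<in> I then add_mset e (coloured d I G) else coloured d I G)"
  by (simp add: coloured_def)

lemma in_coloured [simp]: "e \<in># coloured d I G \<longleftrightarrow> e \<in># G \<and> map_uprod d e \<in> I"
  by (auto simp: coloured_def)

lemma coloured_subset: "coloured d I G \<subseteq># G"
  by (simp add: coloured_def)

lemma coloured_partition: "coloured d I G + coloured d (- I) G = G"
  unfolding coloured_def by (simp add: multiset_partition[symmetric])

text \<open>
  An edge at \<open>v\<close> has the colour \<open>{i, j}\<close> exactly if \<open>v\<close> has one of the degrees \<open>i\<close> and \<open>j\<close> and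
  the label that the edge contributes at \<open>v\<close> is the other one.
\<close>

lemma chromatic_degree_eq_degree:
  assumes "multigraph n G"
  shows "(if d v = i then count (image_mset d (neighbours n G v)) j
          else if d v = j then count (image_mset d (neighbours n G v)) i else 0)
     = degree (coloured d {Upair i j} G) v"
  using assms
proof (induction G)
  case empty
  then show ?case by simp
next
  case (add e G)
  obtain a b where e: "e = Upair a b" by (cases e)
  have ab: "a < n" "b < n" using add.prems by (auto simp: e)
  have IH: "degree (coloured d {Upair i j} G) v =
      (if d v = i then count (image_mset d (neighbours n G v)) j
       else if d v = j then count (image_mset d (neighbours n G v)) i else 0)"
    using add by (simp add: e)
  have "degree (coloured d {Upair i j} (add_mset e G)) v =
      degree (coloured d {Upair i j} G) v +
        (if Upair (d a) (d b) = Upair i j then (if a = v then 1 else 0) + (if b = v then 1 else 0) else 0)"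
    by (simp add: e degree_add_edge)
  then show ?case
    unfolding IH e neighbours_add_edge[OF ab]
    by (cases "a = v"; cases "b = v"; cases "d v = i"; cases "d v = j") auto
qed

lemma multichromatic_degree_eq_degree:
  assumes "realization G S" "v < length S" "finite I"
  shows "multichromatic_degree I (S ! v) = degree (coloured (\<lambda>w. size (S ! w)) I G) v"
proof -
  let ?d = "\<lambda>w. size (S ! w)"
  have G: "multigraph (length S) G" "image_mset ?d (neighbours (length S) G v) = S ! v"
    using assms by (auto simp: realization_iff_sizes)
  have "chromatic_degree c (S ! v) = degree (coloured ?d {c} G) v" for c
  proof (cases c)
    case (Upair i j)
    show ?thesis
      using chromatic_degree_eq_degree[OF G(1), of ?d v i j]
      unfolding Upair chromatic_degree_Upair G(2) by simp
  qed
  moreover have "(\<Sum>c\<in>I. degree (coloured ?d {c} M) v) = degree (coloured ?d I M) v" for M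
  proof (induction M)
    case empty
    then show ?case by simp
  next
    case (add e M)
    obtain a b where e: "e = Upair a b" by (cases e)
    let ?k = "(if a = v then 1 else 0) + (if b = v then 1 else 0) :: nat"
    have "(\<Sum>c\<in>I. degree (coloured ?d {c} (add_mset e M)) v) =
        (\<Sum>c\<in>I. degree (coloured ?d {c} M) v + (if c = map_uprod ?d e then ?k else 0))"
      by (rule sum.cong) (auto simp: e degree_add_edge)
    also have "\<dots> = degree (coloured ?d I M) v + (if map_uprod ?d e \<in> I then ?k else 0)"
      using assms(3) add.IH by (simp add: sum.distrib sum.delta')
    also have "\<dots> = degree (coloured ?d I (add_mset e M)) v"
      by (auto simp: e degree_add_edge)
    finally show ?case .
  qed
  ultimately show ?thesis by (simp add: multichromatic_degree_def)
qed

section \<open>Swaps\<close>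

text \<open>
  The last condition says that \<open>uv\<close> lies on a cycle which does not use \<open>xy\<close>. Without it a swap could
  disconnect the graph.
\<close>

definition cyclic_swap :: "(nat \<Rightarrow> nat) \<Rightarrow> edges \<Rightarrow> edges \<Rightarrow> bool" where
  "cyclic_swap d G G' \<longleftrightarrow> (\<exists>N u v x y.
     G = add_mset (Upair u v) (add_mset (Upair x y) N) \<and>
     G' = add_mset (Upair u y) (add_mset (Upair x v) N) \<and>
     d u = d x \<and> d v = d y \<and> conn N u v)"

text \<open>
  The old edges can be recovered as connections: \<open>u\<close> and \<open>v\<close> by the rest of the cycle, and \<open>x\<close> and
  \<open>y\<close> by the detour \<open>x, v, u, y\<close>.
\<close>

lemma swap_conn_mono:
  assumes "conn N u v" "conn (add_mset (Upair u v) (add_mset (Upair x y) N)) p q"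
  shows "conn (add_mset (Upair u y) (add_mset (Upair x v) N)) p q"
proof -
  let ?G = "add_mset (Upair u y) (add_mset (Upair x v) N)"
  have "conn ?G u v" using assms(1) by (rule conn_mono) auto
  moreover have "conn ?G u y" "conn ?G x v" by (auto intro!: conn_edge)
  ultimately have xy: "conn ?G x y" by (meson conn_sym conn_trans)
  show ?thesis
    using assms(2)
  proof (rule conn_least)
    fix a b assume "Upair a b \<in># add_mset (Upair u v) (add_mset (Upair x y) N)"
    then show "conn ?G a b"
      using \<open>conn ?G u v\<close> xy conn_sym by (auto intro: conn_edge)
  qed
qed

lemma cyclic_swap_conn_mono: "cyclic_swap d G G' \<Longrightarrow> conn G p q \<Longrightarrow> conn G' p q"
  unfolding cyclic_swap_def using swap_conn_mono by blast

lemma cyclic_swap_multigraph: "cyclic_swap d G G' \<Longrightarrow> multigraph n G \<Longrightarrow> multigraph n G'"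
  by (auto simp: cyclic_swap_def)

text \<open>
  This is why swaps preserve realizations: \<open>u\<close> exchanges its neighbour \<open>v\<close> for \<open>y\<close>, of the same
  degree, and likewise for \<open>v\<close>, \<open>x\<close> and \<open>y\<close>.
\<close>

lemma cyclic_swap_labels:
  assumes "cyclic_swap d G G'" "multigraph n G"
  shows "image_mset d (neighbours n G' v) = image_mset d (neighbours n G v)"
  using assms by (auto simp: cyclic_swap_def neighbours_add_edge)

definition support :: "(nat \<Rightarrow> nat) \<Rightarrow> nat uprod \<Rightarrow> edges \<Rightarrow> nat set" where
  "support d b G = {v. \<exists>e \<in># G. map_uprod d e = b \<and> v \<in> set_uprod e}"

lemma in_support: "e \<in># G \<Longrightarrow> v \<in> set_uprod e \<Longrightarrow> v \<in> support d (map_uprod d e) G"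
  unfolding support_def by blast

text \<open>
  The two new edges have the colour of the two old ones and together the same ends.
\<close>

lemma cyclic_swap_support: "cyclic_swap d G G' \<Longrightarrow> support d b G' = support d b G"
  by (auto simp: cyclic_swap_def support_def)

abbreviation reach :: "(nat \<Rightarrow> nat) \<Rightarrow> edges \<Rightarrow> edges \<Rightarrow> bool" where
  "reach d \<equiv> (cyclic_swap d)\<^sup>*\<^sup>*"

lemma reach_conn_mono: "reach d G G' \<Longrightarrow> conn G p q \<Longrightarrow> conn G' p q"
  by (induction rule: rtranclp_induct) (auto intro: cyclic_swap_conn_mono)

lemma reach_multigraph: "reach d G G' \<Longrightarrow> multigraph n G \<Longrightarrow> multigraph n G'"
  by (induction rule: rtranclp_induct) (auto intro: cyclic_swap_multigraph)

lemma reach_labels: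
  "reach d G G' \<Longrightarrow> multigraph n G \<Longrightarrow>
     image_mset d (neighbours n G' v) = image_mset d (neighbours n G v)"
  by (induction rule: rtranclp_induct) (auto simp: cyclic_swap_labels reach_multigraph)

lemma reach_support: "reach d G G' \<Longrightarrow> support d b G' = support d b G"
  by (induction rule: rtranclp_induct) (auto simp: cyclic_swap_support)

lemma reach_realization:
  assumes "reach (\<lambda>w. size (S ! w)) G G'" "realization G S"
  shows "realization G' S"
  using assms by (simp add: realization_iff_sizes reach_multigraph reach_labels)

text \<open>
  Swaps only enlarge the connectivity relation, and on finitely many vertices it cannot grow forever.
\<close>

lemma maximally_connected_exists:
  assumes "multigraph n G0"
  shows "\<exists>G. reach d G0 G \<and> (\<forall>G'. reach d G G' \<longrightarrow> conn G' = conn G)"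
proof -
  define C where "C G = {(x, y). conn G x y \<and> x \<noteq> y}" for G
  have C: "C G \<subseteq> {..<n} \<times> {..<n}" if "reach d G0 G" for G
    using conn_multigraph[OF _ reach_multigraph[OF that assms]] by (auto simp: C_def)
  have fin: "finite (C G)" if "reach d G0 G" for G
    by (rule finite_subset[OF C[OF that]]) simp
  have bound: "card (C G) \<le> card ({..<n} \<times> {..<n})" if "reach d G0 G" for G
    by (rule card_mono[OF _ C[OF that]]) simp
  obtain G where G: "reach d G0 G" "\<And>G'. reach d G0 G' \<Longrightarrow> card (C G') \<le> card (C G)"
  proof -
    have "\<exists>G. reach d G0 G \<and> (\<forall>G'. reach d G0 G' \<longrightarrow> card (C G') \<le> card (C G))"
      by (rule ex_has_greatest_nat[where k = G0 and b = "Suc (card ({..<n} \<times> {..<n}))"])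
        (use bound in \<open>simp_all add: less_Suc_eq_le\<close>)
    then show thesis using that by blast
  qed
  have "conn G' = conn G" if "reach d G G'" for G'
  proof -
    have r: "reach d G0 G'" using G(1) that by simp
    have "C G \<subseteq> C G'" using reach_conn_mono[OF that] by (auto simp: C_def)
    then have "C G = C G'"
      using G(2)[OF r] fin[OF r] by (simp add: card_seteq)
    then have "conn G x y \<longleftrightarrow> conn G' x y" for x y
      by (cases "x = y") (auto simp: C_def set_eq_iff)
    then show ?thesis by auto
  qed
  with G(1) show ?thesis by blast
qed

section \<open>Colours that occur on cycles\<close>

text \<open>
  The colours that occur on a cycle of some multigraph reachable from \<open>G0\<close>. Taking all reachable
  multigraphs together is what makes the edges of the remaining colours bridges in each of them.
\<close>

definition cycle_colours :: "(nat \<Rightarrow> nat) \<Rightarrow> edges \<Rightarrow> nat uprod set" where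
  "cycle_colours d G0 = {map_uprod d e | e G. reach d G0 G \<and> e \<in># G \<and> joins (G - {#e#}) e}"

text \<open>
  \<open>bridges_do_not_connect\<close> for the form in which it is used below, where \<open>K\<close> consists of edges of a
  reachable multigraph whose colours occur on no cycle.
\<close>

lemma conn_without_other_colours:
  assumes "reach d G0 G" "B + K \<subseteq># G" "\<And>g. g \<in># K \<Longrightarrow> map_uprod d g \<notin> cycle_colours d G0"
    and "conn (A + K) x y" "conn B x y" "\<And>a b. conn A a b \<Longrightarrow> conn B a b"
  shows "conn A x y"
  using assms(4-6)
proof (rule bridges_do_not_connect)
  fix g assume g: "g \<in># K"
  show "\<not> joins (B + K - {#g#}) g"
  proof
    assume "joins (B + K - {#g#}) g"
    moreover have "set_mset (B + K - {#g#}) \<subseteq> set_mset (G - {#g#})"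
      using assms(2) by (auto simp: in_diff_count mset_subset_eq_exists_conv)
    ultimately have "joins (G - {#g#}) g" by (rule joins_mono)
    moreover have "g \<in># G" using g assms(2) by (auto dest: mset_subset_eqD)
    ultimately show False using assms(1,3) g by (auto simp: cycle_colours_def)
  qed
qed

lemma map_uprod_eq_cases:
  assumes "map_uprod d f = map_uprod d (Upair u v)"
  obtains x y where "f = Upair x y" "d u = d x" "d v = d y"
proof -
  obtain a b where f: "f = Upair a b" by (cases f)
  have "Upair (d a) (d b) = Upair (d u) (d v)" using assms unfolding f by simp
  then have "d a = d u \<and> d b = d v \<or> d a = d v \<and> d b = d u" unfolding Upair_inject .
  then show thesis
  proof
    assume "d a = d u \<and> d b = d v"
    with that[OF f] show thesis by simp
  next
    assume "d a = d v \<and> d b = d u"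
    moreover have "f = Upair b a" using f by simp
    ultimately show thesis using that[of b a] by simp
  qed
qed

text \<open>
  The cycle through \<open>uv\<close> consists of edges with colours in \<open>R\<close> only, so within these colours the
  swap is again one that only enlarges connectivity. It cannot enlarge it properly: what becomes
  connected within \<open>R\<close> was connected before by way of edges of other colours, because the
  connectivity of the whole graph is maximal; one of these edges would then lie on a cycle.
\<close>

lemma swap_conn_cycle_colours:
  fixes d G0
  defines "R \<equiv> cycle_colours d G0"
  assumes max: "\<And>G. reach d G0 G \<Longrightarrow> conn G = conn G0"
    and G: "reach d G0 G" and swap: "cyclic_swap d G G'"
  shows "conn (coloured d R G') = conn (coloured d R G)"
proof -
  obtain N u v x y where
      eq: "G = add_mset (Upair u v) (add_mset (Upair x y) N)"
        "G' = add_mset (Upair u y) (add_mset (Upair x v) N)"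
    and d: "d u = d x" "d v = d y" and uv: "conn N u v"
    using swap unfolding cyclic_swap_def by blast
  have G': "reach d G0 G'" using G swap by (rule rtranclp.rtrancl_into_rtrancl)
  let ?K = "coloured d (- R) N" and ?N = "coloured d R N"
  have N: "?N + ?K = N" by (rule coloured_partition)
  have "joins (G - {#Upair u v#}) (Upair u v)"
    using uv by (auto simp: eq intro: conn_mono)
  moreover have "Upair u v \<in># G" by (simp add: eq)
  ultimately have "map_uprod d (Upair u v) \<in> R"
    unfolding R_def cycle_colours_def using G by blast
  then have R: "Upair (d u) (d v) \<in> R" by simp
  have R': "Upair (d x) (d y) \<in> R" "Upair (d u) (d y) \<in> R" "Upair (d x) (d v) \<in> R"
    using R unfolding d by this+
  have GR: "coloured d R G = add_mset (Upair u v) (add_mset (Upair x y) ?N)"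
    and GR': "coloured d R G' = add_mset (Upair u y) (add_mset (Upair x v) ?N)"
    using R R' unfolding eq by simp_all
  have "conn ?N u v"
  proof (rule conn_without_other_colours[OF G, where K = ?K and B = "add_mset (Upair u v) ?N"])
    show "add_mset (Upair u v) ?N + ?K \<subseteq># G" by (simp add: N eq)
    show "conn (?N + ?K) u v" by (simp add: N uv)
  qed (auto simp: R_def intro: conn_edge conn_mono)
  then have le: "conn (coloured d R G') p q" if "conn (coloured d R G) p q" for p q
    using that swap_conn_mono unfolding GR GR' by blast
  have "conn (coloured d R G) p q" if pq: "conn (coloured d R G') p q" for p q
  proof (rule conn_without_other_colours[OF G', where K = ?K and B = "coloured d R G'"])
    have eqs: "coloured d R G + ?K = G" "coloured d R G' + ?K = G'"
      unfolding GR GR' by (simp_all add: N eq)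
    show "coloured d R G' + ?K \<subseteq># G'" by (simp add: eqs)
    have "conn G' p q" using pq by (rule conn_mono) auto
    then show "conn (coloured d R G + ?K) p q" by (simp add: eqs max[OF G] max[OF G'])
  qed (use pq le in \<open>auto simp: R_def\<close>)
  with le have "conn (coloured d R G') p q \<longleftrightarrow> conn (coloured d R G) p q" for p q
    by blast
  then show ?thesis by (intro ext)
qed

text \<open>
  Choose a reachable multigraph in which an edge \<open>uv\<close> of colour \<open>b\<close> lies on a cycle, and let \<open>xy\<close>
  be another edge of this colour. If the cycle avoids \<open>xy\<close>, swapping connects \<open>x\<close> with \<open>v\<close>, and
  by invariance they were connected before. If not, both edges are on one cycle, all of whose colours
  are in \<open>R\<close>.
\<close>

lemma cycle_colour_connected:
  fixes d G0
  defines "R \<equiv> cycle_colours d G0"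
  assumes max: "\<And>G. reach d G0 G \<Longrightarrow> conn G = conn G0"
    and b: "b \<in> R" and pq: "p \<in> support d b G0" "q \<in> support d b G0"
  shows "conn (coloured d R G0) p q"
proof -
  obtain e G where e: "b = map_uprod d e" "reach d G0 G" "e \<in># G" "joins (G - {#e#}) e"
    using b unfolding R_def cycle_colours_def by blast
  obtain u v where uv: "e = Upair u v" by (cases e)
  let ?C = "conn (coloured d R G)"
  have "conn (coloured d R G') = conn (coloured d R G0)" if "reach d G0 G'" for G'
    using that
  proof (induction rule: rtranclp_induct)
    case (step G1 G2)
    then show ?case using swap_conn_cycle_colours[OF max step.hyps] by (simp add: R_def)
  qed simp
  note same = this
  have Cuv: "?C u v" using e(1,3) b by (intro conn_edge) (simp add: uv)
  have *: "?C u w" if w: "w \<in> support d b G" for w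
  proof -
    obtain f where f: "f \<in># G" "map_uprod d f = b" "w \<in> set_uprod f"
      using w by (auto simp: support_def)
    show ?thesis
    proof (cases "f = e")
      case True
      then show ?thesis using f(3) Cuv by (auto simp: uv)
    next
      case False
      have "map_uprod d f = map_uprod d (Upair u v)" using f(2) e(1) by (simp only: uv)
      then obtain x y where xy: "f = Upair x y" "d u = d x" "d v = d y"
        by (rule map_uprod_eq_cases)
      define N where "N = G - {#e#} - {#f#}"
      have GN: "G = add_mset (Upair u v) (add_mset (Upair x y) N)"
      proof -
        have "f \<in># G - {#e#}" using f(1) False by (simp add: in_diff_count)
        then have "add_mset f N = G - {#e#}" unfolding N_def by (rule insert_DiffM)
        then have "add_mset e (add_mset f N) = G" using insert_DiffM[OF e(3)] by (simp only:)
        then show ?thesis by (simp add: uv xy(1))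
      qed
      have Cxy: "?C x y" using f(1,2) b by (intro conn_edge) (simp add: xy(1))
      have "?C u x"
      proof (cases "conn N u v")
        case True
        define G' where "G' = add_mset (Upair u y) (add_mset (Upair x v) N)"
        have swap: "cyclic_swap d G G'"
          unfolding cyclic_swap_def by (intro exI conjI) (rule GN G'_def xy(2,3) True)+
        have "reach d G0 G'"
          using e(2) swap by (rule rtranclp.rtrancl_into_rtrancl)
        then have C: "conn (coloured d R G') = ?C" using same[OF e(2)] by (rule trans[OF same sym])
        have "map_uprod d (Upair x v) = b" by (simp add: e(1) uv xy(2))
        then have "conn (coloured d R G') x v"
          using b by (intro conn_edge) (simp add: G'_def)
        then show ?thesis unfolding C by (rule conn_trans[OF Cuv conn_sym])
      next
        case False
        have "conn (add_mset (Upair x y) N) u v" using e(4) by (simp add: GN uv)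
        then have sides: "conn N u x \<and> conn N y v \<or> conn N u y \<and> conn N x v"
          using False by (simp add: conn_add_edge)
        have xyN: "\<not> conn N x y"
        proof
          assume "conn N x y"
          then have yx: "conn N y x" by (rule conn_sym)
          from sides have "conn N u v"
          proof
            assume "conn N u x \<and> conn N y v"
            then show ?thesis using conn_trans[OF conn_trans[OF _ \<open>conn N x y\<close>]] by blast
          next
            assume "conn N u y \<and> conn N x v"
            then show ?thesis using conn_trans[OF conn_trans[OF _ yx]] by blast
          qed
          with False show False ..
        qed
        let ?N = "coloured d R N" and ?K = "coloured d (- R) N"
        have N: "?N + ?K = N" by (rule coloured_partition)
        have "conn (add_mset (Upair u v) ?N) x y"
        proof (rule conn_without_other_colours[OF e(2), where K = ?K
              and B = "add_mset (Upair u v) (add_mset (Upair x y) ?N)"])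
          show "add_mset (Upair u v) (add_mset (Upair x y) ?N) + ?K \<subseteq># G"
            by (simp add: N GN)
          have "conn (add_mset (Upair u v) N) x y"
            unfolding conn_add_edge using sides conn_sym[of N] by blast
          then show "conn (add_mset (Upair u v) ?N + ?K) x y" by (simp add: N)
        qed (auto simp: R_def intro: conn_edge conn_mono)
        moreover have "conn N r s" if "conn ?N r s" for r s
          using that by (rule conn_mono) auto
        ultimately have "conn ?N x u \<or> conn ?N x v"
          using xyN unfolding conn_add_edge by blast
        moreover have "?C r s" if "conn ?N r s" for r s
          using that by (rule conn_mono) (auto simp: GN)
        ultimately have "?C x u \<or> ?C x v" by blast
        then show ?thesis
        proof
          assume "?C x v"
          then show ?thesis by (rule conn_trans[OF Cuv conn_sym])
        qed (rule conn_sym)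
      qed
      then show ?thesis using f(3) conn_trans[OF _ Cxy, of u] by (auto simp: xy(1))
    qed
  qed
  have "p \<in> support d b G" "q \<in> support d b G"
    using pq reach_support[OF e(2)] by simp_all
  then have "?C p q" using conn_trans[OF conn_sym[OF *] *] by blast
  then show ?thesis using same[OF e(2)] by simp
qed

text \<open>
  In the second case \<open>H\<close> is the set of the colours of one component of \<open>G\<^sub>R\<close>, the one that contains
  an edge \<open>e\<close> on a cycle. As each colour of \<open>R\<close> is confined to one component, the edges with
  colours in \<open>H\<close> are precisely the edges of this component.
\<close>

lemma acyclic_or_connected_colours:
  assumes "multigraph n G0"
  obtains (acyclic) G where "reach d G0 G" "acyclic_edges G"
  | (cyclic) G H e where "reach d G0 G" "e \<in># coloured d H G" "joins (coloured d H G - {#e#}) e"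
      "\<And>f g x y. f \<in># coloured d H G \<Longrightarrow> g \<in># coloured d H G \<Longrightarrow>
         x \<in> set_uprod f \<Longrightarrow> y \<in> set_uprod g \<Longrightarrow> conn (coloured d H G) x y"
proof -
  obtain G where G: "reach d G0 G" and max: "\<And>G'. reach d G G' \<Longrightarrow> conn G' = conn G"
    using maximally_connected_exists[OF assms] by blast
  show thesis
  proof (cases "acyclic_edges G")
    case True
    with G show thesis by (rule acyclic)
  next
    case False
    then obtain e where e: "e \<in># G" "joins (G - {#e#}) e"
      by (auto simp: acyclic_edges_def)
    obtain u v where uv: "e = Upair u v" by (cases e)
    define R where "R = cycle_colours d G"
    let ?C = "conn (coloured d R G)"
    define H where "H = {b \<in> R. \<exists>w \<in> support d b G. ?C u w}"
    have eR: "map_uprod d e \<in> R"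
      unfolding R_def cycle_colours_def using e by blast
    have eH: "map_uprod d e \<in> H"
    proof -
      have "u \<in> support d (map_uprod d e) G"
        using e(1) by (rule in_support) (simp add: uv)
      then show ?thesis using eR conn_refl unfolding H_def by blast
    qed
    \<comment> \<open>A path from u with colours in R stays in the component of u, where all colours are in H.\<close>
    have restrict: "conn (coloured d H M) u w" if "M \<subseteq># G" "conn (coloured d R M) u w" for M w
      using that(2) unfolding conn_def[of "coloured d R M"]
    proof (induction rule: rtranclp_induct)
      case (step y z)
      have "Upair y z \<in># G" using step.hyps(2) that(1) by (auto dest: mset_subset_eqD)
      then have "y \<in> support d (map_uprod d (Upair y z)) G" by (rule in_support) simp
      moreover have "conn (coloured d R M) u y"
        using step.hyps(1) unfolding conn_def .
      then have "?C u y"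
        by (rule conn_mono) (use that(1) in \<open>auto dest: mset_subset_eqD\<close>)
      ultimately have "map_uprod d (Upair y z) \<in> H"
        using step.hyps(2) by (auto simp: H_def)
      then have "Upair y z \<in># coloured d H M" using step.hyps(2) by simp
      then show ?case by (rule conn_trans[OF step.IH conn_edge])
    qed simp
    have touch: "conn (coloured d H G) u x" if f: "f \<in># coloured d H G" "x \<in> set_uprod f" for f x
    proof -
      have x: "x \<in> support d (map_uprod d f) G" using f by (intro in_support) simp_all
      obtain w where w: "w \<in> support d (map_uprod d f) G" "?C u w" "map_uprod d f \<in> R"
        using f(1) by (auto simp: H_def)
      have "?C w x"
        using cycle_colour_connected[OF max, where b = "map_uprod d f" and p = w and q = x] w x
        by (simp add: R_def)
      with w(2) have "?C u x" by (rule conn_trans)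
      then show ?thesis by (rule restrict[OF subset_mset.order_refl])
    qed
    let ?M = "G - {#e#}"
    have M: "coloured d R ?M + coloured d (- R) ?M = ?M" by (rule coloured_partition)
    have "conn (coloured d R ?M) u v"
    proof (rule conn_without_other_colours[where B = "add_mset e (coloured d R ?M)"
          and K = "coloured d (- R) ?M"])
      show "reach d G G" by simp
      show "add_mset e (coloured d R ?M) + coloured d (- R) ?M \<subseteq># G"
        using e(1) by (simp add: M)
      show "conn (coloured d R ?M + coloured d (- R) ?M) u v"
        unfolding M using e(2) by (simp add: uv)
    qed (auto simp: R_def uv intro: conn_edge conn_mono)
    then have "conn (coloured d H ?M) u v" by (rule restrict[rotated]) simp
    moreover have "coloured d H ?M = coloured d H G - {#e#}"
      using eH by (simp add: coloured_def)
    ultimately have "joins (coloured d H G - {#e#}) e" by (simp add: uv)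
    moreover have "e \<in># coloured d H G" using e(1) eH by simp
    moreover have "conn (coloured d H G) x y"
      if "f \<in># coloured d H G" "g \<in># coloured d H G" "x \<in> set_uprod f" "y \<in> set_uprod g" for f g x y
      using conn_trans[OF conn_sym[OF touch[OF that(1,3)]] touch[OF that(2,4)]] .
    ultimately show thesis using cyclic[OF G] by blast
  qed
qed

section \<open>The characterisation\<close>

text \<open>
  Equal degrees give equal numbers of edges, and the edges of \<open>F\<close> join nonisolated vertices of \<open>M\<close>.
  These are still connected in \<open>M\<close> without \<open>e\<close>, which has one edge less; so \<open>F\<close> is too large to be
  acyclic.
\<close>

lemma no_forest_with_connected_cyclic_degrees:
  assumes "multigraph n M" "e \<in># M" "joins (M - {#e#}) e"
    and conn: "\<And>f g x y. f \<in># M \<Longrightarrow> g \<in># M \<Longrightarrow> x \<in> set_uprod f \<Longrightarrow> y \<in> set_uprod g \<Longrightarrow> conn M x y"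
    and F: "forest n F" and deg: "\<And>v. v < n \<Longrightarrow> degree F v = degree M v"
  shows False
proof -
  have FM: "multigraph n F" "acyclic_edges F"
    using F forest_iff_acyclic by (auto simp: forest_def)
  obtain u v where uv: "e = Upair u v" by (cases e)
  define N where "N = M - {#e#}"
  have MN: "M = add_mset (Upair u v) N" using assms(2) by (simp add: N_def uv)
  have "conn N u v" using assms(3) by (simp add: N_def uv)
  have N: "conn N x y" if "conn M x y" for x y
    using that
  proof (rule conn_least)
    fix a b assume "Upair a b \<in># M"
    then show "conn N a b"
      using \<open>conn N u v\<close> conn_sym by (auto simp: MN intro: conn_edge)
  qed
  have inc: "\<exists>f \<in># M. x \<in> set_uprod f" if "g \<in># F" "x \<in> set_uprod g" for g x
  proof -
    have "x < n" using FM(1) that by (auto simp: multigraph_def)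
    moreover have "degree F x > 0" using that degree_pos_iff by blast
    ultimately show ?thesis using deg degree_pos_iff by metis
  qed
  have "size F \<le> size N"
  proof (rule acyclic_size_le[OF FM])
    show "multigraph n N" using assms(1) by (simp add: MN)
    show "joins N g" if g: "g \<in># F" for g
      unfolding joins_def
    proof (intro ballI)
      fix x y assume "x \<in> set_uprod g" "y \<in> set_uprod g"
      then obtain f f' where "f \<in># M" "x \<in> set_uprod f" "f' \<in># M" "y \<in> set_uprod f'"
        using inc[OF g] by blast
      then show "conn N x y" by (intro N conn)
    qed
  qed
  moreover have "2 * size F = 2 * size M"
    using sum_degree[OF FM(1)] sum_degree[OF assms(1)] deg by simp
  ultimately show False by (simp add: MN)
qed

lemma realization_colours:
  assumes "realization G S" "e \<in># G"
  shows "map_uprod (\<lambda>w. size (S ! w)) e \<in> colors (max_degree S)"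
proof -
  obtain a b where e: "e = Upair a b" by (cases e)
  have *: "size (S ! x) \<in> {1..max_degree S}" if x: "x \<in> set_uprod e" for x
  proof -
    have "x < length S"
      using assms x by (auto simp: realization_def multigraph_def)
    moreover have "degree G x > 0" using assms(2) x degree_pos_iff by blast
    ultimately have "size (S ! x) > 0" using realization_degree[OF assms(1)] by simp
    moreover have "size (S ! x) \<le> max_degree S"
      unfolding max_degree_def using \<open>x < length S\<close> by (intro Max_ge) auto
    ultimately show ?thesis by simp
  qed
  have "size (S ! a) \<in> {1..max_degree S}" "size (S ! b) \<in> {1..max_degree S}"
    using *[of a] *[of b] by (simp_all add: e)
  then show ?thesis
    unfolding colors_def e by (cases "size (S ! a) = size (S ! b)") auto
qed

lemma finite_colors: "finite (colors \<Delta>)"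
proof -
  have "colors \<Delta> \<subseteq> (\<lambda>(i, j). Upair i j) ` ({1..\<Delta>} \<times> {1..\<Delta>})"
    by (auto simp: colors_def)
  then show ?thesis by (rule finite_subset) simp
qed

theorem theorem14:
  fixes S :: "stub_star list" and \<Delta> :: nat
  assumes "ensemble S" and "\<Delta> = max_degree S"
  shows "forest_realizable S \<longleftrightarrow>
    multigraph_realizable S \<and>
    (\<forall>I \<subseteq> colors \<Delta>. forest_realizable_sequence (map (multichromatic_degree I) S))"
proof
  let ?n = "length S" and ?d = "\<lambda>w. size (S ! w)"
  assume "forest_realizable S"
  then obtain G where G: "realization G S" "forest ?n G"
    by (auto simp: forest_realizable_def)
  have mG: "multigraph ?n G" using G(2) by (simp add: forest_def)
  have "forest_realizable_sequence (map (multichromatic_degree I) S)" if I: "I \<subseteq> colors \<Delta>" for I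
  proof -
    have "acyclic_edges (coloured ?d I G)"
      using forest_iff_acyclic[OF mG] G(2) acyclic_edges_mono coloured_subset by blast
    then have "forest ?n (coloured ?d I G)"
      using forest_iff_acyclic multigraph_mono[OF mG coloured_subset] by blast
    moreover have "finite I" using I finite_colors finite_subset by blast
    ultimately show ?thesis
      unfolding forest_realizable_sequence_def
      by (intro exI[of _ "coloured ?d I G"]) (simp add: multichromatic_degree_eq_degree[OF G(1)])
  qed
  with G(1) show "multigraph_realizable S \<and>
      (\<forall>I \<subseteq> colors \<Delta>. forest_realizable_sequence (map (multichromatic_degree I) S))"
    by (auto simp: multigraph_realizable_def)
next
  let ?n = "length S" and ?d = "\<lambda>w. size (S ! w)"
  assume R: "multigraph_realizable S \<and>
      (\<forall>I \<subseteq> colors \<Delta>. forest_realizable_sequence (map (multichromatic_degree I) S))"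
  then obtain G0 where G0: "realization G0 S"
    by (auto simp: multigraph_realizable_def)
  then have mG0: "multigraph ?n G0" by (simp add: realization_def)
  from mG0 show "forest_realizable S"
  proof (cases rule: acyclic_or_connected_colours[where d = ?d])
    case (acyclic G)
    then have G: "realization G S" using reach_realization G0 by blast
    then have "multigraph ?n G" by (simp add: realization_def)
    with acyclic(2) have "forest ?n G" by (simp add: forest_iff_acyclic)
    with G show ?thesis by (auto simp: forest_realizable_def)
  next
    case (cyclic G H e)
    have G: "realization G S" using reach_realization G0 cyclic(1) by blast
    then have mG: "multigraph ?n G" by (simp add: realization_def)
    \<comment> \<open>Colours of edges of G are colours of the ensemble, so H may be cut down to these.\<close>
    define I where "I = H \<inter> colors \<Delta>"
    have HI: "coloured ?d H G = coloured ?d I G"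
      unfolding coloured_def I_def assms(2)
      using realization_colours[OF G] by (intro filter_mset_cong) auto
    have I: "I \<subseteq> colors \<Delta>" "finite I" by (auto simp: I_def finite_colors)
    have "forest_realizable_sequence (map (multichromatic_degree I) S)" using R I(1) by blast
    then obtain F where F: "forest ?n F"
        "\<And>v. v < ?n \<Longrightarrow> degree F v = multichromatic_degree I (S ! v)"
      by (auto simp: forest_realizable_sequence_def)
    have "degree F v = degree (coloured ?d I G) v" if "v < ?n" for v
      using F(2)[OF that] multichromatic_degree_eq_degree[OF G that I(2)] by simp
    then have "\<And>v. v < ?n \<Longrightarrow> degree F v = degree (coloured ?d H G) v" by (simp add: HI)
    with multigraph_mono[OF mG coloured_subset] cyclic(2-4) F(1) have False
      by (rule no_forest_with_connected_cyclic_degrees)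
    then show ?thesis ..
  qed
qed

end
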